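(* Let $(p,E)$ be a bar framework in $\mathbb{R}^d$ with $n$ vertices and $m$ edges $E_1,\dots,E_m$, let $k\in\{1,\dots,m\}$, and consider the optimization problems $P_k^{\pm}$ with prescribed lengths $l_i=|p_{i,1}-p_{i,2}|$ for $i\ne k$ (so that $p$ is feasible). Then $p$ satisfies the KKT conditions for $P_k^{\pm}$ with some Lagrange multiplier $\lambda$ if and only if the framework $(p,E)$ has a self-stress $\omega$ with $\omega_k\neq 0$. Furthermore, the Lagrange multipliers are in one-to-one correspondence with the self-stresses having nonzero $k$th component, up to scaling: each self-stress $\omega$ with $\omega_k\ne 0$ gives rise to a Lagrange multiplier $\lambda=\omega/\omega_k$, and each Lagrange multiplier $\lambda$ gives rise to a direction of self-stresses spanned by $\omega=\lambda$.
   Context: A bar framework $(p,E)$ in $\mathbb{R}^d$ consists of vertex positions $p=(p_1,\dots,p_n)\in\mathbb{R}^{nd}$, $p_i\in\mathbb{R}^d$, and edges $E=\{E_1,\dots,E_m\}$, each edge joining two distinct vertices; the endpoints of $E_i$ are denoted $p_{i,1},p_{i,2}\in\mathbb{R}^d$. Set $f_i(p)=|p_{i,1}-p_{i,2}|^2$. The rigidity matrix $R(p)\in\mathbb{R}^{m\times nd}$ has $i$th row $\nabla f_i(p)$. A self-stress of $(p,E)$ is a vector $\omega\in\mathbb{R}^m$ with $R(p)^T\omega=0$. Given lengths $l_i$ ($i\neq k$), problem $P_k^{\pm}$ is: $\min_{p\in\mathbb{R}^{nd}} \pm f_k(p)$ subject to $f_i(p)=l_i^2$ for $i=1,\dots,m$,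 $i\ne k$ ($P_k^+$ minimizes $f_k$, $P_k^-$ maximizes $f_k$). A point is feasible if it satisfies the constraints. A point $p$ satisfies the KKT conditions for $P_k^{\pm}$ if it is feasible and there is $\lambda\in\mathbb{R}^m$ (a Lagrange multiplier) with $\lambda_k=1$ and $\sum_{i=1}^m\lambda_i\nabla f_i(p)=0$. *)

theory Defs
  imports "HOL-Analysis.Analysis"
begin

text \<open>
  A configuration of the vertices \<open>'n\<close> in \<open>d\<close>-space is a single vector of \<open>real ^ ('n \<times> 'd)\<close>,
  so that the rigidity matrix is a genuine \<open>m \<times> nd\<close> matrix. Edges are indexed by \<open>'m\<close>; an edge is
  given by its two endpoints, in an arbitrary order.
\<close>

definition vertex_pos :: "real ^ ('n::finite \<times> 'd::finite) \<Rightarrow> 'n \<Rightarrow> real ^ 'd" where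
  "vertex_pos p v = (\<chi> a. p $ (v, a))"

text \<open>The second condition says that \<open>E\<close> enumerates a set of \<open>m\<close> edges, without repetition.\<close>

definition framework_edges :: "('m \<Rightarrow> 'n \<times> 'n) \<Rightarrow> bool" where
  "framework_edges E \<longleftrightarrow>
     (\<forall>i. fst (E i) \<noteq> snd (E i)) \<and> inj (\<lambda>i. {fst (E i), snd (E i)})"

definition edge_length :: "('m \<Rightarrow> 'n \<times> 'n) \<Rightarrow> 'm \<Rightarrow> real ^ ('n::finite \<times> 'd::finite) \<Rightarrow> real" where
  "edge_length E i p = norm (vertex_pos p (fst (E i)) - vertex_pos p (snd (E i)))"

definition edge_fun :: "('m \<Rightarrow> 'n \<times> 'n) \<Rightarrow> 'm \<Rightarrow> real ^ ('n::finite \<times> 'd::finite) \<Rightarrow> real" where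
  "edge_fun E i p = (edge_length E i p)\<^sup>2"

definition gradient :: "('a::real_inner \<Rightarrow> real) \<Rightarrow> 'a \<Rightarrow> 'a" where
  "gradient f x = (THE D. GDERIV f x :> D)"

definition rigidity_matrix ::
  "('m::finite \<Rightarrow> 'n \<times> 'n) \<Rightarrow> real ^ ('n::finite \<times> 'd::finite) \<Rightarrow> real ^ ('n \<times> 'd) ^ 'm" where
  "rigidity_matrix E p = (\<chi> i. gradient (edge_fun E i) p)"

definition self_stress ::
  "('m::finite \<Rightarrow> 'n \<times> 'n) \<Rightarrow> real ^ ('n::finite \<times> 'd::finite) \<Rightarrow> real ^ 'm \<Rightarrow> bool" where
  "self_stress E p \<omega> \<longleftrightarrow> transpose (rigidity_matrix E p) *v \<omega> = 0"

text \<open>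
  The problem \<open>P\<^sub>k\<^sup>+\<close> has sense \<open>Minimize\<close> and \<open>P\<^sub>k\<^sup>-\<close> has sense \<open>Maximize\<close>. The value of
  \<open>lengths\<close> at the objective edge is irrelevant.
\<close>

datatype sense = Minimize | Maximize

record ('m, 'n) edge_problem =
  edges :: "'m \<Rightarrow> 'n \<times> 'n"
  objective_edge :: 'm
  sense :: sense
  lengths :: "'m \<Rightarrow> real"

definition objective :: "('m, 'n) edge_problem \<Rightarrow> real ^ ('n::finite \<times> 'd::finite) \<Rightarrow> real" where
  "objective P q =
     (case sense P of Minimize \<Rightarrow> edge_fun (edges P) (objective_edge P) q
                    | Maximize \<Rightarrow> - edge_fun (edges P) (objective_edge P) q)"

definition feasible :: "('m, 'n) edge_problem \<Rightarrow> real ^ ('n::finite \<times> 'd::finite) \<Rightarrow> bool" where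
  "feasible P q \<longleftrightarrow> (\<forall>i. i \<noteq> objective_edge P \<longrightarrow> edge_fun (edges P) i q = (lengths P i)\<^sup>2)"

definition solution :: "('m, 'n) edge_problem \<Rightarrow> real ^ ('n::finite \<times> 'd::finite) \<Rightarrow> bool" where
  "solution P q \<longleftrightarrow> is_arg_min (objective P) (feasible P) q"

text \<open>
  The sense does not enter the KKT conditions: the objectives of the two problems differ by a sign,
  and in both cases the multipliers are normalised to have entry \<open>1\<close> at the objective edge.
\<close>

definition lagrange_multiplier ::
  "('m::finite, 'n) edge_problem \<Rightarrow> real ^ ('n::finite \<times> 'd::finite) \<Rightarrow> real ^ 'm \<Rightarrow> bool" where
  "lagrange_multiplier P q \<mu> \<longleftrightarrow>
     \<mu> $ objective_edge P = 1 \<and> (\<Sum>i\<in>UNIV. \<mu> $ i *\<^sub>R gradient (edge_fun (edges P) i) q) = 0"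

definition satisfies_KKT ::
  "('m::finite, 'n) edge_problem \<Rightarrow> real ^ ('n::finite \<times> 'd::finite) \<Rightarrow> bool" where
  "satisfies_KKT P q \<longleftrightarrow> feasible P q \<and> (\<exists>\<mu>. lagrange_multiplier P q \<mu>)"

definition scaling_rel :: "'a::real_vector set \<Rightarrow> ('a \<times> 'a) set" where
  "scaling_rel S = {(x, y). x \<in> S \<and> y \<in> S \<and> (\<exists>c. c \<noteq> 0 \<and> y = c *\<^sub>R x)}"

lemma equiv_scaling_rel: "equiv S (scaling_rel S)"
proof (rule equivI)
  show "scaling_rel S \<subseteq> S \<times> S"
    by (auto simp: scaling_rel_def)
  show "refl_on S (scaling_rel S)"
    by (auto simp: refl_on_def scaling_rel_def intro!: exI[of _ 1])
  show "sym (scaling_rel S)"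
  proof (rule symI)
    fix x y assume "(x, y) \<in> scaling_rel S"
    then obtain c where c: "x \<in> S" "y \<in> S" "c \<noteq> 0" "y = c *\<^sub>R x"
      by (auto simp: scaling_rel_def)
    then have "inverse c \<noteq> 0 \<and> x = inverse c *\<^sub>R y" by simp
    with c show "(y, x) \<in> scaling_rel S"
      unfolding scaling_rel_def by blast
  qed
  show "trans (scaling_rel S)"
  proof (rule transI)
    fix x y z assume "(x, y) \<in> scaling_rel S" "(y, z) \<in> scaling_rel S"
    then obtain c c' where c: "x \<in> S" "z \<in> S" "c \<noteq> 0" "c' \<noteq> 0" "z = c' *\<^sub>R c *\<^sub>R x"
      by (auto simp: scaling_rel_def)
    then have "c' * c \<noteq> 0 \<and> z = (c' * c) *\<^sub>R x" by simp
    with c show "(x, z) \<in> scaling_rel S"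
      unfolding scaling_rel_def by blast
  qed
qed

end

theory Submission
  imports Defs
begin

text \<open>
  Since \<open>R(p)\<^sup>T \<omega>\<close> is the combination of the rows \<open>\<nabla>f\<^sub>i(p)\<close> of the rigidity matrix with
  coefficients \<open>\<omega>\<^sub>i\<close>, the stationarity equation of the KKT conditions is the self-stress equation:
  a Lagrange multiplier is nothing but a self-stress normalised by \<open>\<omega>\<^sub>k = 1\<close>
  (\<open>lagrange_multiplier_iff_self_stress\<close>).

  The self-stresses form a linear subspace, on which \<open>\<omega> \<mapsto> \<omega>\<^sub>k\<close> is a linear functional. The
  correspondence is then the affine chart of a projective space: every line of the subspace on
  which the functional does not vanish meets the hyperplane where it equals \<open>1\<close> in exactly one
  point, obtained by dividing by the value of the functional
  (\<open>bij_betw_normalized_scaling_classes\<close>).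
\<close>

lemma self_stress_iff_sum_gradient:
  "self_stress E p \<omega> \<longleftrightarrow> (\<Sum>i\<in>UNIV. \<omega> $ i *\<^sub>R gradient (edge_fun E i) p) = 0"
proof -
  have "transpose (rigidity_matrix E p) *v \<omega> = (\<Sum>i\<in>UNIV. \<omega> $ i *\<^sub>R gradient (edge_fun E i) p)"
    by (simp add: vec_eq_iff matrix_vector_mult_def transpose_def rigidity_matrix_def
        mult.commute)
  then show ?thesis
    by (simp add: self_stress_def)
qed

lemma lagrange_multiplier_iff_self_stress:
  "lagrange_multiplier P p \<mu> \<longleftrightarrow> self_stress (edges P) p \<mu> \<and> \<mu> $ objective_edge P = 1"
  by (auto simp: lagrange_multiplier_def self_stress_iff_sum_gradient)

lemma subspace_self_stress: "subspace {\<omega>. self_stress E p \<omega>}"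
  by (auto simp: subspace_def self_stress_def matrix_vector_right_distrib
      matrix_vector_mult_scaleR simp del: transpose_matrix_vector)

lemma scaling_class_scaleR:
  assumes "x \<in> S" and "c *\<^sub>R x \<in> S" and "c \<noteq> 0"
  shows "scaling_rel S `` {c *\<^sub>R x} = scaling_rel S `` {x}"
proof -
  have "(x, c *\<^sub>R x) \<in> scaling_rel S"
    using assms by (auto simp: scaling_rel_def)
  then show ?thesis
    using equiv_class_eq [OF equiv_scaling_rel] by metis
qed

text \<open>
  Two points of a line through the origin on which a linear functional takes the same nonzero value
  coincide, which gives injectivity; dividing a representative of a class by its value produces
  the normalised representative, which gives surjectivity.
\<close>

lemma bij_betw_normalized_scaling_classes:
  fixes \<phi> :: "'a::real_vector \<Rightarrow> real"
  assumes "linear \<phi>" and "subspace U"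
  defines "S \<equiv> {x \<in> U. \<phi> x \<noteq> 0}"
  shows "bij_betw (\<lambda>x. scaling_rel S `` {x}) {x \<in> U. \<phi> x = 1} (S // scaling_rel S)"
proof (rule bij_betw_imageI)
  have scale: "\<phi> (c *\<^sub>R x) = c * \<phi> x" for c x
    using linear_scale [OF \<open>linear \<phi>\<close>] by simp
  show "inj_on (\<lambda>x. scaling_rel S `` {x}) {x \<in> U. \<phi> x = 1}"
  proof (rule inj_onI)
    fix x y
    assume x: "x \<in> {x \<in> U. \<phi> x = 1}" and y: "y \<in> {x \<in> U. \<phi> x = 1}"
      and eq: "scaling_rel S `` {x} = scaling_rel S `` {y}"
    have "y \<in> S"
      using y by (simp add: S_def)
    then have "(x, y) \<in> scaling_rel S"
      using eq_equiv_class [OF eq equiv_scaling_rel] by blast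
    then obtain c where c: "y = c *\<^sub>R x"
      by (auto simp: scaling_rel_def)
    then have "c = 1"
      using x y by (simp add: scale)
    with c show "x = y"
      by simp
  qed
  show "(\<lambda>x. scaling_rel S `` {x}) ` {x \<in> U. \<phi> x = 1} = S // scaling_rel S"
  proof (intro equalityI subsetI)
    fix X
    assume "X \<in> (\<lambda>x. scaling_rel S `` {x}) ` {x \<in> U. \<phi> x = 1}"
    then obtain x where "x \<in> U" "\<phi> x = 1" "X = scaling_rel S `` {x}"
      by blast
    then show "X \<in> S // scaling_rel S"
      by (simp add: S_def quotientI)
  next
    fix X
    assume "X \<in> S // scaling_rel S"
    then obtain x where x: "x \<in> S" and X: "X = scaling_rel S `` {x}"
      by (rule quotientE)
    define y where "y = (1 / \<phi> x) *\<^sub>R x"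
    have y: "y \<in> U" "\<phi> y = 1"
      using x \<open>subspace U\<close> by (simp_all add: y_def S_def scale subspace_scale)
    then have "scaling_rel S `` {y} = X"
      using x scaling_class_scaleR [of x S "1 / \<phi> x"] by (simp add: X y_def S_def)
    with y show "X \<in> (\<lambda>x. scaling_rel S `` {x}) ` {x \<in> U. \<phi> x = 1}"
      by blast
  qed
qed

theorem lemma3p1:
  fixes E :: "'m::finite \<Rightarrow> 'n::finite \<times> 'n"
    and p :: "real ^ ('n \<times> 'd::finite)"
    and k :: 'm and s :: sense and l :: "'m \<Rightarrow> real"
    and P :: "('m, 'n) edge_problem"
    and \<Lambda> S :: "(real ^ 'm) set"
  assumes "framework_edges E"
    and "\<And>i. i \<noteq> k \<Longrightarrow> l i = edge_length E i p"
  defines "P \<equiv> \<lparr>edges = E, objective_edge = k, sense = s, lengths = l\<rparr>"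
    and "\<Lambda> \<equiv> {\<mu>. lagrange_multiplier P p \<mu>}"
    and "S \<equiv> {\<omega>. self_stress E p \<omega> \<and> \<omega> $ k \<noteq> 0}"
  shows "(satisfies_KKT P p \<longleftrightarrow> (\<exists>\<omega>. self_stress E p \<omega> \<and> \<omega> $ k \<noteq> 0))
    \<and> bij_betw (\<lambda>\<mu>. scaling_rel S `` {\<mu>}) \<Lambda> (S // scaling_rel S)
    \<and> (\<forall>\<omega>\<in>S. (1 / \<omega> $ k) *\<^sub>R \<omega> \<in> \<Lambda>
           \<and> scaling_rel S `` {(1 / \<omega> $ k) *\<^sub>R \<omega>} = scaling_rel S `` {\<omega>})
    \<and> (\<forall>\<mu>\<in>\<Lambda>. \<mu> \<in> S \<and> (\<forall>\<omega>\<in>span {\<mu>}. self_stress E p \<omega>))"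
proof -
  let ?U = "{\<omega>. self_stress E p \<omega>}"
  have \<Lambda>: "\<Lambda> = {\<mu> \<in> ?U. \<mu> $ k = 1}" and S: "S = {\<omega> \<in> ?U. \<omega> $ k \<noteq> 0}"
    by (auto simp: \<Lambda>_def S_def P_def lagrange_multiplier_iff_self_stress)
  have feasible: "feasible P p"
    using assms(2) by (simp add: feasible_def P_def edge_fun_def)
  have normalized: "(1 / \<omega> $ k) *\<^sub>R \<omega> \<in> \<Lambda>" if "\<omega> \<in> S" for \<omega>
    using that subspace_scale [OF subspace_self_stress] by (auto simp: \<Lambda> S)
  have "\<Lambda> \<subseteq> S"
    by (auto simp: \<Lambda> S)
  have "satisfies_KKT P p \<longleftrightarrow> \<Lambda> \<noteq> {}"
    using feasible by (auto simp: satisfies_KKT_def \<Lambda>_def)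
  also have "\<dots> \<longleftrightarrow> S \<noteq> {}"
    using normalized \<open>\<Lambda> \<subseteq> S\<close> by blast
  finally have KKT: "satisfies_KKT P p \<longleftrightarrow> (\<exists>\<omega>. self_stress E p \<omega> \<and> \<omega> $ k \<noteq> 0)"
    by (auto simp: S)
  have "linear (\<lambda>\<omega>::real ^ 'm. \<omega> $ k)"
    by (simp add: linear_iff)
  then have bij: "bij_betw (\<lambda>\<mu>. scaling_rel S `` {\<mu>}) \<Lambda> (S // scaling_rel S)"
    unfolding \<Lambda> S using subspace_self_stress by (rule bij_betw_normalized_scaling_classes)
  have class_eq: "scaling_rel S `` {(1 / \<omega> $ k) *\<^sub>R \<omega>} = scaling_rel S `` {\<omega>}" if "\<omega> \<in> S" for \<omega>
  proof (rule scaling_class_scaleR [OF that])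
    show "(1 / \<omega> $ k) *\<^sub>R \<omega> \<in> S"
      using normalized [OF that] \<open>\<Lambda> \<subseteq> S\<close> by blast
    show "1 / \<omega> $ k \<noteq> 0"
      using that by (simp add: S)
  qed
  have "span {\<mu>} \<subseteq> ?U" if "\<mu> \<in> \<Lambda>" for \<mu>
    using that by (intro span_minimal subspace_self_stress) (auto simp: \<Lambda>)
  with KKT bij normalized class_eq \<open>\<Lambda> \<subseteq> S\<close> show ?thesis
    by blast
qed

end
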